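(* Let $(\hat L,[-,-]_{\hat L},\hat R,\hat d)$ be an abelian extension of a Reynolds LieDer pair $(L,[-,-],R,d)$ by $(V,[-,-]_V,R_V,d_V)$, let $s:L\to\hat L$ be a section of it, and let $\rho(a)u=[s(a),u]_{\hat L}$ for $a\in L$, $u\in V$. Define $\Theta:\wedge^2L\to V$, $\chi:L\to V$, $\xi:L\to V$ by $$\Theta(a,b)=[s(a),s(b)]_{\hat L}-s([a,b]),\quad \chi(a)=\hat d(s(a))-s(d(a)),\quad \xi(a)=\hat R(s(a))-s(R(a)).$$ On $L\oplus V$ put, for $a,b\in L$, $u,v\in V$, $$[a+u,b+v]_\Theta=[a,b]+\Theta(a,b)+\rho(a)v-\rho(b)u,\quad R_\xi(a+u)=R(a)+R_V(u)+\xi(a),\quad d_\chi(a+u)=d(a)+d_V(u)+\chi(a).$$ Then $(L\oplus V,[-,-]_\Theta,R_\xi,d_\chi)$ is a Reynolds LieDer pair if and only if $(\Theta,\xi,\chi)$ is a $2$-cocycle of the Reynolds LieDer pair $(L,[-,-],R,d)$ with coefficients in the representation $(V;\rho,R_V,d_V)$.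
   Context: All vector spaces are over a fixed ground field. A Reynolds operator on a Lie algebra $(L,[-,-])$ is a linear map $R:L\to L$ with $[Rx,Ry]=R([Rx,y]+[x,Ry]-[Rx,Ry])$. A Reynolds LieDer pair $(L,[-,-],R,d)$ is a Lie algebra with a Reynolds operator $R$ and a derivation $d:L\to L$ such that $R\circ d=d\circ R$; a morphism of Reynolds LieDer pairs is a Lie algebra homomorphism commuting with the Reynolds operators and with the derivations. A representation of $(L,[-,-],R,d)$ is $(V;\rho,R_V,d_V)$ where $\rho:L\to\mathrm{gl}(V)$ is a representation of the Lie algebra $L$ and $R_V,d_V:V\to V$ are linear maps such that $\rho(Rx)R_V(u)=R_V(\rho(Rx)u+\rho(x)R_V(u)-\rho(Rx)R_V(u))$, $d_V\rho(x)u=\rho(dx)u+\rho(x)d_V(u)$, and $R_V\circ d_V=d_V\circ R_V$. An extension of $(L,[-,-],R,d)$ by a Reynolds LieDer pair $(V,[-,-]_V,R_V,d_V)$ is a Reynolds LieDer pair $(\hat L,[-,-]_{\hat L},\hat R,\hat d)$ together with a short exact sequence $0\to V\xrightarrow{i}\hat L\xrightarrow{p}L\to0$ of morphisms of Reynolds LieDer pairs; $V$ is identified with $i(V)\subset\hat L$. It is abelian if $[-,-]_V=0$. A section is a linear map $s:L\to\hat L$ with $p\circ s=\mathrm{Id}_L$. With $\rho(a)u=[s(a),u]_{\hat L}$, $(V;\rho,R_V,d_V)$ is a representation of $(L,[-,-],R,d)$. Cohomology. For $f\in\mathrm{Hom}(\wedge^nL,V)$, $n\ge1$: $$(\delta_{CE}f)(x_1,\dots,x_{n+1})=\sum_{i=1}^{n+1}(-1)^{i+n}\rho(x_i)f(x_1,\dots,\hat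 x_i,\dots,x_{n+1})+\sum_{1\le i<j\le n+1}(-1)^{i+j+n+1}f([x_i,x_j],x_1,\dots,\hat x_i,\dots,\hat x_j,\dots,x_{n+1});$$ $\delta_R$ is given by the same formula with $[x,y]$ replaced by $[x,y]_R=[x,Ry]+[Rx,y]-[Rx,Ry]$ and $\rho$ by $\rho_R(x)u=\rho(Rx)u+R_V(\rho(Rx)u-\rho(x)u)$; $$(\varphi f)(x_1,\dots,x_n)=f(Rx_1,\dots,Rx_n)-R_V\sum_{i=1}^nf(Rx_1,\dots,Rx_{i-1},x_i,Rx_{i+1},\dots,Rx_n)+(n-1)R_Vf(Rx_1,\dots,Rx_n);$$ $$(\Delta f)(x_1,\dots,x_n)=\sum_{i=1}^nf(x_1,\dots,dx_i,\dots,x_n)-d_V(f(x_1,\dots,x_n)).$$ A $2$-cochain of the Reynolds LieDer pair is a triple $(\Theta,\xi,\chi)=((\Theta,\xi),\chi)$ with $\Theta\in\mathrm{Hom}(\wedge^2L,V)$, $\xi,\chi\in\mathrm{Hom}(L,V)$. Its coboundary is $$\mathfrak{D}_{\mathrm{RLieDer}}(\Theta,\xi,\chi)=\big((\delta_{CE}\Theta,\,-\delta_R\xi-\varphi\Theta),\,(\delta_{CE}\chi+\Delta\Theta,\,\Delta\xi-\varphi\chi)\big),$$ and it is a $2$-cocycle if this vanishes. *)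

theory Defs
  imports Complex_Main "HOL-Library.Product_Plus"
begin

text \<open>
  Vector spaces over the ground field \<open>'k\<close> are whole types with a scalar multiplication
  satisfying \<^locale>\<open>vector_space\<close>.
\<close>

locale lie_algebra = vector_space scale
  for scale :: "'k::field \<Rightarrow> 'a::ab_group_add \<Rightarrow> 'a" +
  fixes bracket :: "'a \<Rightarrow> 'a \<Rightarrow> 'a"
  assumes bracket_linear_left: "\<And>y. Vector_Spaces.linear scale scale (\<lambda>x. bracket x y)"
    and bracket_linear_right: "\<And>x. Vector_Spaces.linear scale scale (\<lambda>y. bracket x y)"
    and bracket_alternating: "\<And>x. bracket x x = 0"
    and jacobi: "\<And>x y z. bracket x (bracket y z) + bracket y (bracket z x) + bracket z (bracket x y) = 0"

locale reynolds_operator = lie_algebra scale bracket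
  for scale :: "'k::field \<Rightarrow> 'a::ab_group_add \<Rightarrow> 'a" and bracket +
  fixes R :: "'a \<Rightarrow> 'a"
  assumes R_linear: "Vector_Spaces.linear scale scale R"
    and reynolds: "\<And>x y. bracket (R x) (R y)
      = R (bracket (R x) y + bracket x (R y) - bracket (R x) (R y))"

locale lie_derivation = lie_algebra scale bracket
  for scale :: "'k::field \<Rightarrow> 'a::ab_group_add \<Rightarrow> 'a" and bracket +
  fixes d :: "'a \<Rightarrow> 'a"
  assumes d_linear: "Vector_Spaces.linear scale scale d"
    and derivation: "\<And>x y. d (bracket x y) = bracket (d x) y + bracket x (d y)"

locale reynolds_lieder_pair =
  reynolds_operator scale bracket R + lie_derivation scale bracket d
  for scale :: "'k::field \<Rightarrow> 'a::ab_group_add \<Rightarrow> 'a" and bracket R d +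
  assumes R_d_commute: "R \<circ> d = d \<circ> R"

locale reynolds_lieder_morphism =
  A: reynolds_lieder_pair scA brA RA dA + B: reynolds_lieder_pair scB brB RB dB
  for scA :: "'k::field \<Rightarrow> 'a::ab_group_add \<Rightarrow> 'a" and brA RA dA
    and scB :: "'k \<Rightarrow> 'b::ab_group_add \<Rightarrow> 'b" and brB RB dB +
  fixes f :: "'a \<Rightarrow> 'b"
  assumes hom_linear: "Vector_Spaces.linear scA scB f"
    and hom_bracket: "\<And>x y. f (brA x y) = brB (f x) (f y)"
    and hom_R: "f \<circ> RA = RB \<circ> f"
    and hom_d: "f \<circ> dA = dB \<circ> f"

locale reynolds_lieder_representation =
  L: reynolds_lieder_pair sc br R d + V: vector_space scV
  for sc :: "'k::field \<Rightarrow> 'l::ab_group_add \<Rightarrow> 'l" and br R d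
    and scV :: "'k \<Rightarrow> 'v::ab_group_add \<Rightarrow> 'v" +
  fixes \<rho> :: "'l \<Rightarrow> 'v \<Rightarrow> 'v" and RV dV :: "'v \<Rightarrow> 'v"
  assumes rho_linear_left: "\<And>u. Vector_Spaces.linear sc scV (\<lambda>x. \<rho> x u)"
    and rho_linear_right: "\<And>x. Vector_Spaces.linear scV scV (\<rho> x)"
    and rho_bracket: "\<And>x y u. \<rho> (br x y) u = \<rho> x (\<rho> y u) - \<rho> y (\<rho> x u)"
    and RV_linear: "Vector_Spaces.linear scV scV RV"
    and dV_linear: "Vector_Spaces.linear scV scV dV"
    and rho_reynolds: "\<And>x u. \<rho> (R x) (RV u) = RV (\<rho> (R x) u + \<rho> x (RV u) - \<rho> (R x) (RV u))"
    and rho_derivation: "\<And>x u. dV (\<rho> x u) = \<rho> (d x) u + \<rho> x (dV u)"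
    and RV_dV_commute: "RV \<circ> dV = dV \<circ> RV"


subsection \<open>Extensions\<close>

locale reynolds_lieder_extension =
  i: reynolds_lieder_morphism scV brV RV dV scE brE RE dE i +
  p: reynolds_lieder_morphism scE brE RE dE sc br R d p
  for sc :: "'k::field \<Rightarrow> 'l::ab_group_add \<Rightarrow> 'l" and br R d
    and scV :: "'k \<Rightarrow> 'v::ab_group_add \<Rightarrow> 'v" and brV RV dV
    and scE :: "'k \<Rightarrow> 'e::ab_group_add \<Rightarrow> 'e" and brE RE dE
    and i :: "'v \<Rightarrow> 'e" and p :: "'e \<Rightarrow> 'l" +
  assumes exact_left: "inj i"
    and exact_middle: "range i = {x. p x = 0}"
    and exact_right: "surj p"

locale abelian_reynolds_lieder_extension =
  reynolds_lieder_extension sc br R d scV brV RV dV scE brE RE dE i p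
  for sc :: "'k::field \<Rightarrow> 'l::ab_group_add \<Rightarrow> 'l" and br R d
    and scV :: "'k \<Rightarrow> 'v::ab_group_add \<Rightarrow> 'v" and brV RV dV
    and scE :: "'k \<Rightarrow> 'e::ab_group_add \<Rightarrow> 'e" and brE RE dE
    and i :: "'v \<Rightarrow> 'e" and p :: "'e \<Rightarrow> 'l" +
  assumes abelian: "\<And>u v. brV u v = 0"

definition extension_section ::
  "('k::field \<Rightarrow> 'l::ab_group_add \<Rightarrow> 'l) \<Rightarrow> ('k \<Rightarrow> 'e::ab_group_add \<Rightarrow> 'e) \<Rightarrow> ('e \<Rightarrow> 'l) \<Rightarrow> ('l \<Rightarrow> 'e) \<Rightarrow> bool"
  where "extension_section sc scE p s \<longleftrightarrow> Vector_Spaces.linear sc scE s \<and> p \<circ> s = id"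

text \<open>
  In the next four definitions \<^term>\<open>inv i\<close> realizes the identification of \<open>V\<close> with \<open>i(V)\<close>; the
  lemmas after them show that its arguments do lie in \<open>i(V)\<close>.
\<close>

definition ext_rho :: "('e \<Rightarrow> 'e \<Rightarrow> 'e) \<Rightarrow> ('v \<Rightarrow> 'e) \<Rightarrow> ('l \<Rightarrow> 'e) \<Rightarrow> 'l \<Rightarrow> 'v \<Rightarrow> 'v"
  where "ext_rho brE i s a u = inv i (brE (s a) (i u))"

definition ext_Theta ::
  "('l \<Rightarrow> 'l \<Rightarrow> 'l) \<Rightarrow> ('e \<Rightarrow> 'e \<Rightarrow> 'e::ab_group_add) \<Rightarrow> ('v \<Rightarrow> 'e) \<Rightarrow> ('l \<Rightarrow> 'e) \<Rightarrow> 'l \<Rightarrow> 'l \<Rightarrow> 'v"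
  where "ext_Theta br brE i s a b = inv i (brE (s a) (s b) - s (br a b))"

definition ext_chi ::
  "('l \<Rightarrow> 'l) \<Rightarrow> ('e \<Rightarrow> 'e::ab_group_add) \<Rightarrow> ('v \<Rightarrow> 'e) \<Rightarrow> ('l \<Rightarrow> 'e) \<Rightarrow> 'l \<Rightarrow> 'v"
  where "ext_chi d dE i s a = inv i (dE (s a) - s (d a))"

definition ext_xi ::
  "('l \<Rightarrow> 'l) \<Rightarrow> ('e \<Rightarrow> 'e::ab_group_add) \<Rightarrow> ('v \<Rightarrow> 'e) \<Rightarrow> ('l \<Rightarrow> 'e) \<Rightarrow> 'l \<Rightarrow> 'v"
  where "ext_xi R RE i s a = inv i (RE (s a) - s (R a))"

context reynolds_lieder_extension
begin

lemma i_inv_i: "p x = 0 \<Longrightarrow> i (inv i x) = x"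
  using exact_middle by (metis (mono_tags) f_inv_into_f mem_Collect_eq)

lemma p_i: "p (i u) = 0"
  using exact_middle by auto

lemma p_diff: "p (x - y) = p x - p y"
  using p.hom_linear by (rule module_hom.diff[OF Vector_Spaces.linear.axioms(3)])

lemma i_ext_rho: "i (ext_rho brE i s a u) = brE (s a) (i u)"
proof -
  interpret B: Vector_Spaces.linear sc sc "\<lambda>y. br x y" for x
    by (rule p.B.bracket_linear_right)
  show ?thesis
    unfolding ext_rho_def by (rule i_inv_i) (simp add: p.hom_bracket p_i B.zero)
qed

context
  fixes s
  assumes section_s: "extension_section sc scE p s"
begin

lemma p_section: "p (s a) = a"
  using section_s by (metis comp_apply extension_section_def id_apply)

lemma i_ext_Theta: "i (ext_Theta br brE i s a b) = brE (s a) (s b) - s (br a b)"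
  unfolding ext_Theta_def by (rule i_inv_i) (simp add: p_diff p.hom_bracket p_section)

lemma i_ext_chi: "i (ext_chi d dE i s a) = dE (s a) - s (d a)"
  unfolding ext_chi_def
  by (rule i_inv_i) (metis p_diff p.hom_d comp_apply p_section diff_self)

lemma i_ext_xi: "i (ext_xi R RE i s a) = RE (s a) - s (R a)"
  unfolding ext_xi_def
  by (rule i_inv_i) (metis p_diff p.hom_R comp_apply p_section diff_self)

end

end


subsection \<open>Cochains\<close>

text \<open>
  An \<open>n\<close>-cochain, i.e. an element of \<open>Hom(\<Lambda>\<^sup>n L, V)\<close>, is an alternating \<open>n\<close>-linear map, given as a
  function of the list \<open>[x\<^sub>1, \<dots>, x\<^sub>n]\<close> of its arguments. Only its values on lists of length \<open>n\<close>
  matter. Positions in formulas are counted from 1, so \<open>x\<^sub>i\<close> is \<open>xs ! (i - 1)\<close>.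
\<close>

definition alternating_hom ::
  "('k::field \<Rightarrow> 'l::ab_group_add \<Rightarrow> 'l) \<Rightarrow> ('k \<Rightarrow> 'v::ab_group_add \<Rightarrow> 'v) \<Rightarrow> nat \<Rightarrow> ('l list \<Rightarrow> 'v) set"
  where "alternating_hom sc scV n = {f.
    (\<forall>xs k. length xs = n \<and> k < n \<longrightarrow> Vector_Spaces.linear sc scV (\<lambda>x. f (xs[k := x]))) \<and>
    (\<forall>xs k l. length xs = n \<and> k < l \<and> l < n \<and> xs ! k = xs ! l \<longrightarrow> f xs = 0)}"

definition cochain1 :: "('l \<Rightarrow> 'v) \<Rightarrow> 'l list \<Rightarrow> 'v"
  where "cochain1 g xs = g (xs ! 0)"

definition cochain2 :: "('l \<Rightarrow> 'l \<Rightarrow> 'v) \<Rightarrow> 'l list \<Rightarrow> 'v"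
  where "cochain2 g xs = g (xs ! 0) (xs ! 1)"

definition omit :: "nat \<Rightarrow> 'l list \<Rightarrow> 'l list"
  where "omit i xs = take (i - 1) xs @ drop i xs"

definition delta_CE ::
  "('l \<Rightarrow> 'l \<Rightarrow> 'l) \<Rightarrow> ('k::field \<Rightarrow> 'v::ab_group_add \<Rightarrow> 'v) \<Rightarrow> ('l \<Rightarrow> 'v \<Rightarrow> 'v) \<Rightarrow>
    nat \<Rightarrow> ('l list \<Rightarrow> 'v) \<Rightarrow> 'l list \<Rightarrow> 'v"
  where "delta_CE br scV \<rho> n f xs =
    (\<Sum>i=1..n+1. scV ((-1) ^ (i + n)) (\<rho> (xs ! (i - 1)) (f (omit i xs)))) +
    (\<Sum>(i, j) | 1 \<le> i \<and> i < j \<and> j \<le> n + 1. scV ((-1) ^ (i + j + n + 1))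
       (f (br (xs ! (i - 1)) (xs ! (j - 1)) # omit i (omit j xs))))"

definition bracket_R :: "('l \<Rightarrow> 'l \<Rightarrow> 'l) \<Rightarrow> ('l \<Rightarrow> 'l) \<Rightarrow> 'l \<Rightarrow> 'l \<Rightarrow> 'l::ab_group_add"
  where "bracket_R br R x y = br x (R y) + br (R x) y - br (R x) (R y)"

definition rho_R ::
  "('l \<Rightarrow> 'l) \<Rightarrow> ('l \<Rightarrow> 'v \<Rightarrow> 'v) \<Rightarrow> ('v \<Rightarrow> 'v) \<Rightarrow> 'l \<Rightarrow> 'v \<Rightarrow> 'v::ab_group_add"
  where "rho_R R \<rho> RV x u = \<rho> (R x) u + RV (\<rho> (R x) u - \<rho> x u)"

definition delta_R ::
  "('l::ab_group_add \<Rightarrow> 'l \<Rightarrow> 'l) \<Rightarrow> ('l \<Rightarrow> 'l) \<Rightarrow> ('k::field \<Rightarrow> 'v::ab_group_add \<Rightarrow> 'v) \<Rightarrow>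
    ('l \<Rightarrow> 'v \<Rightarrow> 'v) \<Rightarrow> ('v \<Rightarrow> 'v) \<Rightarrow> nat \<Rightarrow> ('l list \<Rightarrow> 'v) \<Rightarrow> 'l list \<Rightarrow> 'v"
  where "delta_R br R scV \<rho> RV = delta_CE (bracket_R br R) scV (rho_R R \<rho> RV)"

definition phi ::
  "('l \<Rightarrow> 'l) \<Rightarrow> ('k::field \<Rightarrow> 'v::ab_group_add \<Rightarrow> 'v) \<Rightarrow> ('v \<Rightarrow> 'v) \<Rightarrow>
    nat \<Rightarrow> ('l list \<Rightarrow> 'v) \<Rightarrow> 'l list \<Rightarrow> 'v"
  where "phi R scV RV n f xs =
    f (map R xs) - RV (\<Sum>i=1..n. f ((map R xs)[i - 1 := xs ! (i - 1)]))
      + scV (of_nat n - 1) (RV (f (map R xs)))"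

definition Delta ::
  "('l \<Rightarrow> 'l) \<Rightarrow> ('v \<Rightarrow> 'v) \<Rightarrow> nat \<Rightarrow> ('l list \<Rightarrow> 'v) \<Rightarrow> 'l list \<Rightarrow> 'v::ab_group_add"
  where "Delta d dV n f xs =
    (\<Sum>i=1..n. f (xs[i - 1 := d (xs ! (i - 1))])) - dV (f xs)"

text \<open>The coboundary of a 2-cochain; its four components take 3, 2, 2 and 1 arguments.\<close>

fun coboundary_RLieDer ::
  "('l::ab_group_add \<Rightarrow> 'l \<Rightarrow> 'l) \<Rightarrow> ('l \<Rightarrow> 'l) \<Rightarrow> ('l \<Rightarrow> 'l) \<Rightarrow>
    ('k::field \<Rightarrow> 'v::ab_group_add \<Rightarrow> 'v) \<Rightarrow> ('l \<Rightarrow> 'v \<Rightarrow> 'v) \<Rightarrow> ('v \<Rightarrow> 'v) \<Rightarrow> ('v \<Rightarrow> 'v) \<Rightarrow>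
    (('l list \<Rightarrow> 'v) \<times> ('l list \<Rightarrow> 'v)) \<times> ('l list \<Rightarrow> 'v) \<Rightarrow>
    (('l list \<Rightarrow> 'v) \<times> ('l list \<Rightarrow> 'v)) \<times> (('l list \<Rightarrow> 'v) \<times> ('l list \<Rightarrow> 'v))"
  where "coboundary_RLieDer br R d scV \<rho> RV dV ((\<Theta>, \<xi>), \<chi>) =
    ((delta_CE br scV \<rho> 2 \<Theta>,
      \<lambda>xs. - delta_R br R scV \<rho> RV 1 \<xi> xs - phi R scV RV 2 \<Theta> xs),
     (\<lambda>xs. delta_CE br scV \<rho> 1 \<chi> xs + Delta d dV 2 \<Theta> xs,
      \<lambda>xs. Delta d dV 1 \<xi> xs - phi R scV RV 1 \<chi> xs))"

definition vanishes :: "nat \<Rightarrow> ('l list \<Rightarrow> 'v::zero) \<Rightarrow> bool"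
  where "vanishes n f \<longleftrightarrow> (\<forall>xs. length xs = n \<longrightarrow> f xs = 0)"

locale reynolds_lieder_2_cocycle =
  reynolds_lieder_representation sc br R d scV \<rho> RV dV
  for sc :: "'k::field \<Rightarrow> 'l::ab_group_add \<Rightarrow> 'l" and br R d
    and scV :: "'k \<Rightarrow> 'v::ab_group_add \<Rightarrow> 'v" and \<rho> RV dV +
  fixes \<Theta> \<xi> \<chi> :: "'l list \<Rightarrow> 'v"
  assumes Theta_cochain: "\<Theta> \<in> alternating_hom sc scV 2"
    and xi_cochain: "\<xi> \<in> alternating_hom sc scV 1"
    and chi_cochain: "\<chi> \<in> alternating_hom sc scV 1"
    and cocycle: "case coboundary_RLieDer br R d scV \<rho> RV dV ((\<Theta>, \<xi>), \<chi>) of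
      ((c3, c2), (c2', c1)) \<Rightarrow> vanishes 3 c3 \<and> vanishes 2 c2 \<and> vanishes 2 c2' \<and> vanishes 1 c1"


subsection \<open>The structure on the direct sum\<close>

definition scale_sum ::
  "('k \<Rightarrow> 'l \<Rightarrow> 'l) \<Rightarrow> ('k \<Rightarrow> 'v \<Rightarrow> 'v) \<Rightarrow> 'k \<Rightarrow> 'l \<times> 'v \<Rightarrow> 'l \<times> 'v"
  where "scale_sum sc scV c = map_prod (sc c) (scV c)"

fun bracket_sum ::
  "('l \<Rightarrow> 'l \<Rightarrow> 'l) \<Rightarrow> ('l \<Rightarrow> 'v \<Rightarrow> 'v) \<Rightarrow> ('l \<Rightarrow> 'l \<Rightarrow> 'v::ab_group_add) \<Rightarrow>
    'l \<times> 'v \<Rightarrow> 'l \<times> 'v \<Rightarrow> 'l \<times> 'v"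
  where "bracket_sum br \<rho> \<Theta> (a, u) (b, v) = (br a b, \<Theta> a b + \<rho> a v - \<rho> b u)"

fun operator_sum ::
  "('l \<Rightarrow> 'l) \<Rightarrow> ('v \<Rightarrow> 'v) \<Rightarrow> ('l \<Rightarrow> 'v::ab_group_add) \<Rightarrow> 'l \<times> 'v \<Rightarrow> 'l \<times> 'v"
  where "operator_sum T TV \<tau> (a, u) = (T a, TV u + \<tau> a)"

end

theory Submission imports Defs begin

text \<open>
  Four axioms of a Reynolds LieDer pair on \<open>L \<oplus> V\<close> relate the bracket and the operators: the Jacobi
  identity, the Reynolds identity, the derivation identity and the commutation of the two operators.
  The difference of the two sides of such an identity is its defect. The \<open>L\<close>-component of a defect is zero, because \<open>L\<close> itself is a
  Reynolds LieDer pair. In the \<open>V\<close>-component every term that contains an argument from \<open>V\<close>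
  cancels: these terms make up the identities that say that \<open>V\<close> is a representation of \<open>L\<close>.
  What is left are the terms with \<open>\<Theta>\<close>, \<open>\<xi>\<close> and \<open>\<chi>\<close>, and up to sign they are a component of the
  coboundary, evaluated at the \<open>L\<close>-parts of the arguments:
  \<^item> the Jacobi defect is \<open>- \<delta>\<^sub>C\<^sub>E \<Theta>\<close> (\<open>jacobi_defect\<close>);
  \<^item> the defect of the Reynolds identity is \<open>\<delta>\<^sub>R \<xi> + \<phi> \<Theta>\<close> (\<open>reynolds_defect\<close>);
  \<^item> the defect of the derivation identity is \<open>- (\<delta>\<^sub>C\<^sub>E \<chi> + \<Delta> \<Theta>)\<close> (\<open>derivation_defect\<close>);
  \<^item> the commutator of the two operators is \<open>\<Delta> \<xi> - \<phi> \<chi>\<close> (\<open>commutation_defect\<close>).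

  The remaining axioms, which say that the bracket is bilinear and alternating and that the two
  operators are linear, follow from the same properties of the cochains.

  Since the arguments are arbitrary, the identities hold on \<open>L \<oplus> V\<close> exactly when the coboundary
  vanishes. This equivalence (\<open>reynolds_lieder_pair_sum_iff_cocycle\<close>) holds for all cochains
  with values in a representation.

  An abelian extension with a section supplies such data. The kernel \<open>V\<close> is an abelian ideal, so
  an element of the extension acts on \<open>V\<close> through its image in \<open>L\<close> alone (\<open>bracket_i\<close>). The
  identities of the extension, for one argument in \<open>V\<close> and the others in \<open>s(L)\<close>, thus turn into
  the identities of a representation. Bilinearity, alternation and linearity of the three cochains
  are inherited from the extension because the inclusion of \<open>V\<close> is injective.
\<close>

section \<open>Coboundaries in low degree\<close>

lemma list1_all: "(\<forall>xs. length xs = 1 \<longrightarrow> P xs) \<longleftrightarrow> (\<forall>x. P [x])"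
  by (auto simp: length_Suc_conv)

lemma list2_all: "(\<forall>xs. length xs = 2 \<longrightarrow> P xs) \<longleftrightarrow> (\<forall>x y. P [x, y])"
  by (auto simp: length_Suc_conv numeral_2_eq_2)

lemma list3_all: "(\<forall>xs. length xs = 3 \<longrightarrow> P xs) \<longleftrightarrow> (\<forall>x y z. P [x, y, z])"
  by (auto simp: length_Suc_conv numeral_3_eq_3)

lemma cochain1_alternating_hom:
  "cochain1 g \<in> alternating_hom sc scV 1 \<longleftrightarrow> Vector_Spaces.linear sc scV g"
proof -
  have "cochain1 g \<in> alternating_hom sc scV 1 \<longleftrightarrow>
      (\<forall>xs::'a list. length xs = 1 \<longrightarrow> Vector_Spaces.linear sc scV (\<lambda>x. cochain1 g (xs[0 := x])))"
    by (auto simp: alternating_hom_def)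
  also have "\<dots> \<longleftrightarrow> Vector_Spaces.linear sc scV g"
    unfolding list1_all by (simp add: cochain1_def)
  finally show ?thesis .
qed

lemma cochain2_alternating_hom:
  "cochain2 g \<in> alternating_hom sc scV 2 \<longleftrightarrow>
    (\<forall>y. Vector_Spaces.linear sc scV (\<lambda>x. g x y)) \<and>
    (\<forall>x. Vector_Spaces.linear sc scV (g x)) \<and> (\<forall>x. g x x = 0)"
proof -
  have less_2_all: "(\<forall>k<2. P k) \<longleftrightarrow> P 0 \<and> P 1" for P :: "nat \<Rightarrow> bool"
    by (auto simp: less_2_cases_iff)
  have less_less_2_all: "(\<forall>k l. k < l \<and> l < 2 \<longrightarrow> P k l) \<longleftrightarrow> P 0 1" for P :: "nat \<Rightarrow> nat \<Rightarrow> bool"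
    by (auto simp: less_2_cases_iff)
  have "cochain2 g \<in> alternating_hom sc scV 2 \<longleftrightarrow>
      (\<forall>xs::'a list. length xs = 2 \<longrightarrow>
        (\<forall>k<2. Vector_Spaces.linear sc scV (\<lambda>x. cochain2 g (xs[k := x]))) \<and>
        (\<forall>k l. k < l \<and> l < 2 \<longrightarrow> xs ! k = xs ! l \<longrightarrow> cochain2 g xs = 0))"
    unfolding alternating_hom_def by blast
  also have "\<dots> \<longleftrightarrow> (\<forall>y. Vector_Spaces.linear sc scV (\<lambda>x. g x y)) \<and>
      (\<forall>x. Vector_Spaces.linear sc scV (g x)) \<and> (\<forall>x. g x x = 0)"
    unfolding less_2_all less_less_2_all list2_all by (auto simp: cochain2_def)
  finally show ?thesis .
qed

lemma index_pairs_2: "{(i, j). 1 \<le> i \<and> i < j \<and> j \<le> (1::nat) + 1} = {(1, 2)}"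
  by auto

lemma index_pairs_3: "{(i, j). 1 \<le> i \<and> i < j \<and> j \<le> (2::nat) + 1} = {(1, 2), (1, 3), (2, 3)}"
  by auto

context vector_space
begin

lemma delta_CE_1:
  "delta_CE br scale \<rho> 1 (cochain1 g) [x, y] = \<rho> x (g y) - \<rho> y (g x) - g (br x y)"
  unfolding delta_CE_def index_pairs_2
  by (simp add: cochain1_def omit_def numeral_2_eq_2)

lemma delta_CE_2:
  "delta_CE br scale \<rho> 2 (cochain2 g) [x, y, z] =
    - \<rho> x (g y z) + \<rho> y (g x z) - \<rho> z (g x y)
    + g (br x y) z - g (br x z) y + g (br y z) x"
  unfolding delta_CE_def index_pairs_3
  by (simp add: cochain2_def omit_def numeral_2_eq_2 numeral_3_eq_3)

lemma phi_1: "phi R scale RV 1 (cochain1 g) [x] = g (R x) - RV (g x)"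
  by (simp add: phi_def cochain1_def)

lemma phi_2:
  "phi R scale RV 2 (cochain2 g) [x, y] =
    g (R x) (R y) - RV (g x (R y) + g (R x) y) + RV (g (R x) (R y))"
  by (simp add: phi_def cochain2_def numeral_2_eq_2)

end

lemma Delta_1: "Delta d dV 1 (cochain1 g) [x] = g (d x) - dV (g x)"
  by (simp add: Delta_def cochain1_def)

lemma Delta_2: "Delta d dV 2 (cochain2 g) [x, y] = g (d x) y + g x (d y) - dV (g x y)"
  by (simp add: Delta_def cochain2_def numeral_2_eq_2)


section \<open>Structures on the direct sum as cocycles\<close>

context lie_algebra
begin

interpretation left: Vector_Spaces.linear scale scale "\<lambda>x. bracket x y" for y
  by (rule bracket_linear_left)
interpretation right: Vector_Spaces.linear scale scale "bracket x" for x
  by (rule bracket_linear_right)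

lemma bracket_skew: "bracket y x = - bracket x y"
proof -
  have "bracket (x + y) (x + y) = bracket x y + bracket y x"
    unfolding left.add right.add by (simp add: bracket_alternating)
  then show ?thesis
    by (simp add: bracket_alternating eq_neg_iff_add_eq_0 add.commute)
qed

lemma jacobi_leibniz:
  "bracket (bracket x y) z = bracket x (bracket y z) - bracket y (bracket x z)"
  using jacobi[of x y z] bracket_skew[of z x] bracket_skew[of z "bracket x y"]
  by (simp add: right.neg algebra_simps)

end

lemma vector_space_scale_sum:
  assumes "vector_space sc" "vector_space scV"
  shows "vector_space (scale_sum sc scV)"
  using assms by (auto simp: vector_space_def scale_sum_def)

lemma linear_operator_sum:
  assumes "Vector_Spaces.linear sc sc T" "Vector_Spaces.linear scV scV TV"
    and "Vector_Spaces.linear sc scV \<tau>"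
  shows "Vector_Spaces.linear (scale_sum sc scV) (scale_sum sc scV) (operator_sum T TV \<tau>)"
proof -
  interpret T: Vector_Spaces.linear sc sc T by fact
  interpret TV: Vector_Spaces.linear scV scV TV by fact
  interpret \<tau>: Vector_Spaces.linear sc scV \<tau> by fact
  have "vector_space (scale_sum sc scV)"
    by (intro vector_space_scale_sum) unfold_locales
  then show ?thesis
    by (auto simp: Vector_Spaces.linear_iff scale_sum_def T.add TV.add \<tau>.add T.scale TV.scale \<tau>.scale
        TV.vs1.scale_right_distrib)
qed

locale reynolds_lieder_2_cochain =
  reynolds_lieder_representation sc br R d scV \<rho> RV dV
  for sc :: "'k::field \<Rightarrow> 'l::ab_group_add \<Rightarrow> 'l" and br R d
    and scV :: "'k \<Rightarrow> 'v::ab_group_add \<Rightarrow> 'v" and \<rho> RV dV +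
  fixes \<Theta> :: "'l \<Rightarrow> 'l \<Rightarrow> 'v" and \<xi> \<chi> :: "'l \<Rightarrow> 'v"
  assumes Theta_linear_left: "\<And>y. Vector_Spaces.linear sc scV (\<lambda>x. \<Theta> x y)"
    and Theta_linear_right: "\<And>x. Vector_Spaces.linear sc scV (\<Theta> x)"
    and Theta_alternating: "\<And>x. \<Theta> x x = 0"
    and xi_linear: "Vector_Spaces.linear sc scV \<xi>"
    and chi_linear: "Vector_Spaces.linear sc scV \<chi>"
begin

abbreviation "brS \<equiv> bracket_sum br \<rho> \<Theta>"
abbreviation "RS \<equiv> operator_sum R RV \<xi>"
abbreviation "dS \<equiv> operator_sum d dV \<chi>"

interpretation br_left: Vector_Spaces.linear sc sc "\<lambda>x. br x y" for y
  by (rule L.bracket_linear_left)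
interpretation br_right: Vector_Spaces.linear sc sc "br x" for x
  by (rule L.bracket_linear_right)
interpretation R: Vector_Spaces.linear sc sc R by (rule L.R_linear)
interpretation d: Vector_Spaces.linear sc sc d by (rule L.d_linear)
interpretation rho_left: Vector_Spaces.linear sc scV "\<lambda>x. \<rho> x u" for u
  by (rule rho_linear_left)
interpretation rho_right: Vector_Spaces.linear scV scV "\<rho> x" for x
  by (rule rho_linear_right)
interpretation RV: Vector_Spaces.linear scV scV RV by (rule RV_linear)
interpretation dV: Vector_Spaces.linear scV scV dV by (rule dV_linear)
interpretation Theta_left: Vector_Spaces.linear sc scV "\<lambda>x. \<Theta> x y" for y
  by (rule Theta_linear_left)
interpretation Theta_right: Vector_Spaces.linear sc scV "\<Theta> x" for x
  by (rule Theta_linear_right)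
interpretation \<xi>: Vector_Spaces.linear sc scV \<xi> by (rule xi_linear)
interpretation \<chi>: Vector_Spaces.linear sc scV \<chi> by (rule chi_linear)

lemmas additive =
  br_left.add br_right.add R.add d.add rho_left.add rho_right.add RV.add dV.add
  Theta_left.add Theta_right.add \<xi>.add \<chi>.add
  br_left.diff br_right.diff R.diff d.diff rho_left.diff rho_right.diff RV.diff dV.diff
  Theta_left.diff Theta_right.diff \<xi>.diff \<chi>.diff
  br_left.neg br_right.neg R.neg d.neg rho_left.neg rho_right.neg RV.neg dV.neg
  Theta_left.neg Theta_right.neg \<xi>.neg \<chi>.neg

lemma Theta_skew: "\<Theta> y x = - \<Theta> x y"
proof -
  have "\<Theta> (x + y) (x + y) = \<Theta> x y + \<Theta> y x"
    unfolding Theta_left.add Theta_right.add by (simp add: Theta_alternating)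
  then show ?thesis
    by (simp add: Theta_alternating eq_neg_iff_add_eq_0 add.commute)
qed

text \<open>
  The terms with \<open>u\<close>, \<open>v\<close>, \<open>w\<close> cancel because \<open>\<rho>\<close> is a Lie algebra homomorphism.
\<close>

lemma jacobi_defect:
  "brS (a, u) (brS (b, v) (c, w)) + brS (b, v) (brS (c, w) (a, u)) + brS (c, w) (brS (a, u) (b, v))
    = (0, - delta_CE br scV \<rho> 2 (cochain2 \<Theta>) [a, b, c])"
proof -
  \<comment> \<open>The cyclic sum is brought to the order of arguments in which the coboundary is written.\<close>
  have "\<Theta> a (br b c) = - \<Theta> (br b c) a" "\<Theta> b (br c a) = \<Theta> (br a c) b"
    "\<Theta> c (br a b) = - \<Theta> (br a b) c" "\<rho> b (\<Theta> c a) = - \<rho> b (\<Theta> a c)"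
    using Theta_skew[of a "br b c"] Theta_skew[of b "br a c"] Theta_skew[of c "br a b"]
    by (simp_all add: L.bracket_skew[of c a] Theta_skew[of c a] Theta_right.neg rho_right.neg)
  then show ?thesis
    by (simp add: L.jacobi V.delta_CE_2 additive rho_bracket)
qed

text \<open>
  The terms with \<open>u\<close> and \<open>v\<close> cancel by the compatibility of \<open>d\<^sub>V\<close> with \<open>\<rho>\<close>.
\<close>

lemma derivation_defect:
  "dS (brS (a, u) (b, v)) - (brS (dS (a, u)) (b, v) + brS (a, u) (dS (b, v)))
    = (0, - (delta_CE br scV \<rho> 1 (cochain1 \<chi>) [a, b] + Delta d dV 2 (cochain2 \<Theta>) [a, b]))"
  unfolding V.delta_CE_1 Delta_2
  by (simp add: L.derivation additive rho_derivation algebra_simps)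

lemma commutation_defect:
  "RS (dS (a, u)) - dS (RS (a, u))
    = (0, Delta d dV 1 (cochain1 \<xi>) [a] - phi R scV RV 1 (cochain1 \<chi>) [a])"
  unfolding V.phi_1 Delta_1 using L.R_d_commute RV_dV_commute
  by (simp add: fun_eq_iff additive)

text \<open>
  The terms with \<open>u\<close> and \<open>v\<close> cancel by the compatibility of \<open>R\<^sub>V\<close> with \<open>\<rho>\<close>. On the left,
  \<open>\<xi>\<close> is acted on by \<open>\<rho> \<circ> R\<close>; on the right, inside \<open>R\<^sub>V\<close>, by \<open>\<rho>\<close> and by \<open>\<rho> \<circ> R\<close>. Together these
  form the twisted action \<open>\<rho>\<^sub>R\<close>, and the \<open>L\<close>-part of the argument of the outer operator is
  \<open>[a, b]\<^sub>R\<close>. This is how \<open>\<delta>\<^sub>R\<close> arises.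
\<close>

lemma reynolds_defect:
  "brS (RS (a, u)) (RS (b, v))
      - RS (brS (RS (a, u)) (b, v) + brS (a, u) (RS (b, v)) - brS (RS (a, u)) (RS (b, v)))
    = (0, delta_R br R scV \<rho> RV 1 (cochain1 \<xi>) [a, b] + phi R scV RV 2 (cochain2 \<Theta>) [a, b])"
proof -
  have "\<rho> (R a) (RV v) = RV (\<rho> (R a) v) + RV (\<rho> a (RV v)) - RV (\<rho> (R a) (RV v))"
    "\<rho> (R b) (RV u) = RV (\<rho> (R b) u) + RV (\<rho> b (RV u)) - RV (\<rho> (R b) (RV u))"
    using rho_reynolds by (simp_all add: additive)
  moreover have "br (R a) (R b) - R (br (R a) b + br a (R b) - br (R a) (R b)) = 0"
    by (simp flip: L.reynolds)
  ultimately show ?thesis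
    unfolding delta_R_def V.delta_CE_1 V.phi_2
    by (simp add: bracket_R_def rho_R_def additive algebra_simps)
qed

lemma vector_space_sum: "vector_space (scale_sum sc scV)"
  by (rule vector_space_scale_sum) unfold_locales

lemma bracket_sum_linear_left:
  "Vector_Spaces.linear (scale_sum sc scV) (scale_sum sc scV) (\<lambda>x. brS x y)"
  using vector_space_sum
  by (cases y) (auto simp: Vector_Spaces.linear_iff scale_sum_def additive br_left.scale
      rho_left.scale rho_right.scale Theta_left.scale V.scale_right_distrib V.scale_right_diff_distrib)

lemma bracket_sum_linear_right:
  "Vector_Spaces.linear (scale_sum sc scV) (scale_sum sc scV) (\<lambda>y. brS x y)"
  using vector_space_sum
  by (cases x) (auto simp: Vector_Spaces.linear_iff scale_sum_def additive br_right.scale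
      rho_left.scale rho_right.scale Theta_right.scale V.scale_right_distrib V.scale_right_diff_distrib)

lemma bracket_sum_alternating: "brS x x = 0"
  by (cases x) (simp add: L.bracket_alternating Theta_alternating zero_prod_def)

theorem reynolds_lieder_pair_sum_iff_cocycle:
  "reynolds_lieder_pair (scale_sum sc scV) brS RS dS \<longleftrightarrow>
    reynolds_lieder_2_cocycle sc br R d scV \<rho> RV dV (cochain2 \<Theta>) (cochain1 \<xi>) (cochain1 \<chi>)"
proof -
  let ?J = "\<forall>x y z. brS x (brS y z) + brS y (brS z x) + brS z (brS x y) = 0"
  let ?R = "\<forall>x y. brS (RS x) (RS y) = RS (brS (RS x) y + brS x (RS y) - brS (RS x) (RS y))"
  let ?D = "\<forall>x y. dS (brS x y) = brS (dS x) y + brS x (dS y)"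
  let ?C = "RS \<circ> dS = dS \<circ> RS"
  have "reynolds_lieder_pair (scale_sum sc scV) brS RS dS \<longleftrightarrow> ?J \<and> ?R \<and> ?D \<and> ?C"
    using vector_space_sum bracket_sum_linear_left bracket_sum_linear_right bracket_sum_alternating
      linear_operator_sum[OF L.R_linear RV_linear xi_linear]
      linear_operator_sum[OF L.d_linear dV_linear chi_linear]
    by (auto simp: reynolds_lieder_pair_def reynolds_lieder_pair_axioms_def reynolds_operator_def
        reynolds_operator_axioms_def lie_derivation_def lie_derivation_axioms_def
        lie_algebra_def lie_algebra_axioms_def)
  \<comment> \<open>Below, each identity is read as the vanishing of its defect.\<close>
  moreover have "?J \<longleftrightarrow> vanishes 3 (delta_CE br scV \<rho> 2 (cochain2 \<Theta>))"
    unfolding vanishes_def list3_all split_paired_All jacobi_defect by (simp add: zero_prod_def)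
  moreover have "?R \<longleftrightarrow> vanishes 2 (\<lambda>xs. - delta_R br R scV \<rho> RV 1 (cochain1 \<xi>) xs
      - phi R scV RV 2 (cochain2 \<Theta>) xs)"
  proof -
    have "- r - t = 0 \<longleftrightarrow> r + t = 0" for r t :: 'v
      by (metis diff_conv_add_uminus minus_add_distrib neg_equal_0_iff_equal)
    then show ?thesis
      unfolding vanishes_def list2_all split_paired_All
      by (subst eq_iff_diff_eq_0) (simp only: reynolds_defect zero_prod_def prod.inject simp_thms)
  qed
  moreover have "?D \<longleftrightarrow> vanishes 2 (\<lambda>xs. delta_CE br scV \<rho> 1 (cochain1 \<chi>) xs
      + Delta d dV 2 (cochain2 \<Theta>) xs)"
    unfolding vanishes_def list2_all split_paired_All
    by (subst eq_iff_diff_eq_0)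
      (simp only: derivation_defect zero_prod_def prod.inject simp_thms neg_equal_0_iff_equal)
  moreover have "?C \<longleftrightarrow> vanishes 1 (\<lambda>xs. Delta d dV 1 (cochain1 \<xi>) xs
      - phi R scV RV 1 (cochain1 \<chi>) xs)"
    unfolding vanishes_def list1_all split_paired_All fun_eq_iff comp_apply
    by (subst eq_iff_diff_eq_0) (simp only: commutation_defect zero_prod_def prod.inject simp_thms)
  moreover have "cochain2 \<Theta> \<in> alternating_hom sc scV 2" "cochain1 \<xi> \<in> alternating_hom sc scV 1"
    "cochain1 \<chi> \<in> alternating_hom sc scV 1"
    unfolding cochain1_alternating_hom cochain2_alternating_hom
    using Theta_linear_left Theta_linear_right Theta_alternating xi_linear chi_linear by auto
  ultimately show ?thesis
    using reynolds_lieder_representation_axioms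
    by (simp add: reynolds_lieder_2_cocycle_def reynolds_lieder_2_cocycle_axioms_def)
qed

end


section \<open>The representation and the cochain of an abelian extension\<close>

text \<open>
  A \<open>V\<close>-valued map built from a section is known through its composition with the inclusion
  \<open>i\<close>, so its linearity is checked in the extension.
\<close>

lemma linear_if_linear_inj_comp:
  assumes "inj i" "Vector_Spaces.linear scV scE i" "Vector_Spaces.linear sc scE (\<lambda>x. i (f x))"
  shows "Vector_Spaces.linear sc scV f"
  using assms unfolding Vector_Spaces.linear_iff by (metis injD)

context abelian_reynolds_lieder_extension
begin

context
  fixes s
  assumes section_s: "extension_section sc scE p s"
begin

abbreviation (input) "rho \<equiv> ext_rho brE i s"

interpretation i: Vector_Spaces.linear scV scE i by (rule i.hom_linear)
interpretation p: Vector_Spaces.linear scE sc p by (rule p.hom_linear)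
interpretation s: Vector_Spaces.linear sc scE s
  using section_s by (simp add: extension_section_def)
interpretation brE_left: Vector_Spaces.linear scE scE "\<lambda>x. brE x y" for y
  by (rule i.B.bracket_linear_left)
interpretation brE_right: Vector_Spaces.linear scE scE "brE x" for x
  by (rule i.B.bracket_linear_right)
interpretation br_left: Vector_Spaces.linear sc sc "\<lambda>x. br x y" for y
  by (rule p.B.bracket_linear_left)
interpretation br_right: Vector_Spaces.linear sc sc "br x" for x
  by (rule p.B.bracket_linear_right)
interpretation R: Vector_Spaces.linear sc sc R by (rule p.B.R_linear)
interpretation d: Vector_Spaces.linear sc sc d by (rule p.B.d_linear)
interpretation RE: Vector_Spaces.linear scE scE RE by (rule i.B.R_linear)
interpretation dE: Vector_Spaces.linear scE scE dE by (rule i.B.d_linear)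

lemmas hom_pointwise = i.hom_R[unfolded fun_eq_iff comp_apply, rule_format]
  i.hom_d[unfolded fun_eq_iff comp_apply, rule_format]
  p.hom_R[unfolded fun_eq_iff comp_apply, rule_format]
  p.hom_d[unfolded fun_eq_iff comp_apply, rule_format]

text \<open>
  The elements \<open>e\<close> and \<open>s(p(e))\<close> differ by an element of \<open>V\<close>, which commutes with \<open>u\<close>. The
  operators and the bracket of the extension need not preserve the image of \<open>s\<close>, but they commute
  with \<open>p\<close>; with this lemma that suffices to compute their effect on \<open>\<rho>\<close>.
\<close>

lemma bracket_i: "brE e (i u) = i (rho (p e) u)"
proof -
  have "p (e - s (p e)) = 0"
    by (simp add: p.diff p_section[OF section_s])
  then obtain v where v: "e - s (p e) = i v"
    by (metis i_inv_i)
  have "brE e (i u) - brE (s (p e)) (i u) = brE (e - s (p e)) (i u)"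
    by (simp add: brE_left.diff)
  also have "\<dots> = 0"
    unfolding v i.hom_bracket[symmetric] abelian by simp
  finally show ?thesis
    by (simp add: i_ext_rho)
qed

lemma ext_rho_representation: "reynolds_lieder_representation sc br R d scV rho RV dV"
proof (intro reynolds_lieder_representation.intro reynolds_lieder_representation_axioms.intro)
  note inj = injD[OF exact_left]
  show "Vector_Spaces.linear sc scV (\<lambda>x. rho x u)" for u
    by (rule linear_if_linear_inj_comp[OF exact_left i.hom_linear])
      (simp add: Vector_Spaces.linear_iff p.B.vector_space_axioms i.B.vector_space_axioms i_ext_rho
        s.add s.scale brE_left.add brE_left.scale)
  show "Vector_Spaces.linear scV scV (rho x)" for x
    by (rule linear_if_linear_inj_comp[OF exact_left i.hom_linear])
      (simp add: Vector_Spaces.linear_iff i.A.vector_space_axioms i.B.vector_space_axioms i_ext_rho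
        i.add i.scale brE_right.add brE_right.scale)
  show "rho (br x y) u = rho x (rho y u) - rho y (rho x u)" for x y u
    using i.B.jacobi_leibniz[of "s x" "s y" "i u"]
    by (intro inj) (simp add: bracket_i p.hom_bracket p_section[OF section_s] i.diff)
  \<comment> \<open>Applying \<open>i\<close> turns the goal into the Reynolds identity of the extension for \<open>s x\<close> and \<open>i u\<close>,
    once all sums and operators in that identity have been moved inside \<open>i\<close>.\<close>
  show "rho (R x) (RV u) = RV (rho (R x) u + rho x (RV u) - rho (R x) (RV u))" for x u
    using i.B.reynolds[of "s x" "i u"]
    by (intro inj) (simp add: bracket_i p_section[OF section_s] hom_pointwise
        i.diff[symmetric] i.add[symmetric] flip: hom_pointwise(1))
  show "dV (rho x u) = rho (d x) u + rho x (dV u)" for x u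
    using i.B.derivation[of "s x" "i u"]
    by (intro inj) (simp add: bracket_i p_section[OF section_s] hom_pointwise
        i.add flip: hom_pointwise(2))
  show "reynolds_lieder_pair sc br R d" by (rule p.B.reynolds_lieder_pair_axioms)
  show "vector_space scV" by (rule i.A.vector_space_axioms)
  show "RV \<circ> dV = dV \<circ> RV" by (rule i.A.R_d_commute)
  show "Vector_Spaces.linear scV scV RV" by (rule i.A.R_linear)
  show "Vector_Spaces.linear scV scV dV" by (rule i.A.d_linear)
qed

lemma ext_cochain:
  "reynolds_lieder_2_cochain sc br R d scV rho RV dV
    (ext_Theta br brE i s) (ext_xi R RE i s) (ext_chi d dE i s)"
proof -
  note linear_V = linear_if_linear_inj_comp[OF exact_left i.hom_linear]
  note linear_simps = Vector_Spaces.linear_iff p.B.vector_space_axioms i.B.vector_space_axioms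
  show ?thesis
  proof (intro reynolds_lieder_2_cochain.intro reynolds_lieder_2_cochain_axioms.intro)
    show "reynolds_lieder_representation sc br R d scV rho RV dV"
      by (rule ext_rho_representation)
    show "Vector_Spaces.linear sc scV (\<lambda>x. ext_Theta br brE i s x y)" for y
      by (rule linear_V) (simp add: linear_simps i_ext_Theta[OF section_s] s.add s.scale
          brE_left.add brE_left.scale br_left.add br_left.scale i.B.scale_right_diff_distrib)
    show "Vector_Spaces.linear sc scV (ext_Theta br brE i s x)" for x
      by (rule linear_V) (simp add: linear_simps i_ext_Theta[OF section_s] s.add s.scale
          brE_right.add brE_right.scale br_right.add br_right.scale i.B.scale_right_diff_distrib)
    show "ext_Theta br brE i s x x = 0" for x
      by (rule injD[OF exact_left])
        (simp add: i_ext_Theta[OF section_s] i.B.bracket_alternating p.B.bracket_alternating)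
    show "Vector_Spaces.linear sc scV (ext_xi R RE i s)"
      by (rule linear_V) (simp add: linear_simps i_ext_xi[OF section_s] s.add s.scale
          R.add R.scale RE.add RE.scale i.B.scale_right_diff_distrib)
    show "Vector_Spaces.linear sc scV (ext_chi d dE i s)"
      by (rule linear_V) (simp add: linear_simps i_ext_chi[OF section_s] s.add s.scale
          d.add d.scale dE.add dE.scale i.B.scale_right_diff_distrib)
  qed
qed

end

end

theorem theorem5p2:
  fixes sc :: "'k::field \<Rightarrow> 'l::ab_group_add \<Rightarrow> 'l" and br :: "'l \<Rightarrow> 'l \<Rightarrow> 'l" and R d :: "'l \<Rightarrow> 'l"
    and scV :: "'k \<Rightarrow> 'v::ab_group_add \<Rightarrow> 'v" and brV :: "'v \<Rightarrow> 'v \<Rightarrow> 'v" and RV dV :: "'v \<Rightarrow> 'v"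
    and scE :: "'k \<Rightarrow> 'e::ab_group_add \<Rightarrow> 'e" and brE :: "'e \<Rightarrow> 'e \<Rightarrow> 'e" and RE dE :: "'e \<Rightarrow> 'e"
    and i :: "'v \<Rightarrow> 'e" and p :: "'e \<Rightarrow> 'l" and s :: "'l \<Rightarrow> 'e"
    and \<rho> :: "'l \<Rightarrow> 'v \<Rightarrow> 'v" and \<Theta> :: "'l \<Rightarrow> 'l \<Rightarrow> 'v" and \<chi> \<xi> :: "'l \<Rightarrow> 'v"
  assumes "abelian_reynolds_lieder_extension sc br R d scV brV RV dV scE brE RE dE i p"
    and "extension_section sc scE p s"
    and "\<rho> = ext_rho brE i s"
    and "\<Theta> = ext_Theta br brE i s"
    and "\<chi> = ext_chi d dE i s"
    and "\<xi> = ext_xi R RE i s"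
  shows "reynolds_lieder_pair (scale_sum sc scV) (bracket_sum br \<rho> \<Theta>)
      (operator_sum R RV \<xi>) (operator_sum d dV \<chi>)
    \<longleftrightarrow> reynolds_lieder_2_cocycle sc br R d scV \<rho> RV dV
      (cochain2 \<Theta>) (cochain1 \<xi>) (cochain1 \<chi>)"
proof -
  interpret reynolds_lieder_2_cochain sc br R d scV \<rho> RV dV \<Theta> \<xi> \<chi>
    unfolding assms(3-6)
    using abelian_reynolds_lieder_extension.ext_cochain[OF assms(1,2)] .
  show ?thesis
    by (rule reynolds_lieder_pair_sum_iff_cocycle)
qed

end
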